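(* Let $(x^k)_{k\ge1}$ be the iterates generated by the GEP-MSCRA algorithm (defined in the context) for data $b=A\overline{x}+\varepsilon$. Let $\widehat{\varepsilon}:=\frac1nA^{\mathbb{T}}\varepsilon$. Suppose that $A$ has the RSC of constant $\kappa$ over $\mathcal{C}(\overline{S},1.5\overline{r})$, and $$\frac{\sqrt3(4-2\overline{t}_\phi)(1-t_\phi^* )}{(3-\overline{t}_\phi)\kappa}\le\nu\le\frac{1-\overline{t}_\phi}{(3-\overline{t}_\phi)\|\mathcal{G}(\widehat{\varepsilon})\|_\infty}.$$ If $$\frac{\nu(3-\overline{t}_\phi)\|\mathcal{G}(\widehat{\varepsilon})\|_\infty}{1-\overline{t}_\phi}\le\rho\le\sqrt{\frac{(3-\overline{t}_\phi)\kappa\nu}{\sqrt3(4-2\overline{t}_\phi)(1-t_\phi^* )}},$$ then $$\|x^1-\overline{x}\|\le\frac{\nu^{-1}(4-2\overline{t}_\phi)}{\kappa(3-\overline{t}_\phi)}\sqrt{1.5\,\overline{r}}\qquad\text{and}\qquad \|x^k-\overline{x}\|\le\frac{\rho\nu^{-1}(4-2\overline{t}_\phi)}{\kappa(3-\overline{t}_\phi)}\sqrt{1.5\,\overline{r}}\quad\text{for } k=2,3,\dots$$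
   Context: $\mathcal{J}_1,\dots,\mathcal{J}_m$ are pairwise disjoint index sets with union $\{1,\dots,p\}$; $x_{\mathcal{J}_i}$ is the subvector of $x\in\mathbb{R}^p$ indexed by $\mathcal{J}_i$; $\|\cdot\|$ is the Euclidean norm; $\mathcal{G}(x):=(\|x_{\mathcal{J}_1}\|,\dots,\|x_{\mathcal{J}_m}\|)^{\mathbb{T}}$. $A\in\mathbb{R}^{n\times p}$, $\overline{x}\in\mathbb{R}^p$ is the true vector, $\varepsilon\in\mathbb{R}^n$ the noise, $b=A\overline{x}+\varepsilon$. $\Omega:=\{x\in\mathbb{R}^p:\|x\|_\infty\le R\}$ for a given $R>0$. $\overline{S}:=\{i:\overline{x}_{\mathcal{J}_i}\ne0\}$, $\overline{r}:=|\overline{S}|$. $L_f$ is the Lipschitz constant of $f(x):=\frac1{2n}\|Ax-b\|^2$ relative to $\Omega$. $\Phi$ is the family of closed proper convex functions $\phi:\mathbb{R}\to(-\infty,+\infty]$ with $[0,1]\subseteq\mathrm{int}(\mathrm{dom}\,\phi)$, $\phi(1)=1$, and $\phi(t_\phi^* )=0$, where $t_\phi^*$ is the unique minimizer of $\phi$ over $[0,1]$. $\overline{t}_\phi$ is the minimum element of $[t_\phi^*,1)$ such that $\frac{1}{1-t_\phi^*}\in\partial\phi(\overline{t}_\phi)$ (it exists); $\phi_-'$ is the left derivative. For $l>0$, $\mathcal{C}(\overline{S},l)$ is the set of $z\in\mathbb{R}^p$ for which there is $S\supseteq\overline{S}$ (subset of $\{1,\dots,m\}$) with $|S|\le l$ and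 $\sum_{i\in S^c}\|z_{\mathcal{J}_i}\|\le\frac{2}{1-\overline{t}_\phi}\sum_{i\in S}\|z_{\mathcal{J}_i}\|$. $A$ has the RSC of constant $\kappa>0$ over a set $\mathcal{C}$ if $\frac{1}{2n}\|Ax\|^2\ge\kappa\|x\|^2$ for all $x\in\mathcal{C}$. GEP-MSCRA: choose $\phi\in\Phi$, $\nu>0$ and $w^0$ with $0\le w^0_i\le\overline{t}_\phi$ for all $i$; set $\lambda^0=\nu^{-1}$. For $k=1,2,\dots$: compute $$x^k\in\arg\min_{x\in\Omega}\Big\{\tfrac{1}{2n}\|Ax-b\|^2+\lambda^{k-1}\sum_{i=1}^m(1-w_i^{k-1})\|x_{\mathcal{J}_i}\|\Big\};$$ after $x^1$ is computed, select (using the information of $x^1$) a suitable $\rho>\overline{\rho}:=\nu L_f\frac{(1-t_\phi^* )\phi_-'(1)}{1-\overline{t}_\phi}$ and set $\lambda^k=\rho\nu^{-1}$ for $k\ge1$; then take $$w_i^k\in\arg\min_{t\in[0,1]}\{\phi(t)-\rho t\|x^k_{\mathcal{J}_i}\|\},\quad i=1,\dots,m.$$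
   Formalization: The formal theorem additionally assumes that the true vector x̄ lies in Ω (‖x̄‖_∞ ≤ R); without this the claim fails, e.g. n=p=m=1, A=1, ε=0, φ(t)=t, R=0.001, x̄=0.01, κ=1/2, ν=1771, ρ=19.5. *)

theory Defs
  imports "HOL-Analysis.Analysis"
begin

definition epigraph_ereal :: "(real \<Rightarrow> ereal) \<Rightarrow> (real \<times> real) set" where
  "epigraph_ereal \<phi> = {(t, r). \<phi> t \<le> ereal r}"

definition closed_proper_convex :: "(real \<Rightarrow> ereal) \<Rightarrow> bool" where
  "closed_proper_convex \<phi> \<longleftrightarrow>
     closed (epigraph_ereal \<phi>) \<and> convex (epigraph_ereal \<phi>) \<and>
     (\<forall>t. \<phi> t \<noteq> -\<infinity>) \<and> (\<exists>t. \<phi> t \<noteq> \<infinity>)"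

definition effective_domain :: "(real \<Rightarrow> ereal) \<Rightarrow> real set" where
  "effective_domain \<phi> = {t. \<phi> t < \<infinity>}"

definition subdifferential :: "(real \<Rightarrow> ereal) \<Rightarrow> real \<Rightarrow> real set" where
  "subdifferential \<phi> t = {s. \<forall>u. \<phi> t + ereal (s * (u - t)) \<le> \<phi> u}"

text \<open>Only meaningful at interior points of the effective domain, where passing to
  \<open>real_of_ereal\<close> loses nothing.\<close>

definition left_derivative :: "(real \<Rightarrow> ereal) \<Rightarrow> real \<Rightarrow> real" where
  "left_derivative \<phi> t =
     (THE D. ((\<lambda>s. real_of_ereal (\<phi> s)) has_real_derivative D) (at_left t))"

definition t_star :: "(real \<Rightarrow> ereal) \<Rightarrow> real" where
  "t_star \<phi> = (THE t. is_arg_min \<phi> (\<lambda>s. s \<in> {0..1}) t)"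

definition Phi_family :: "(real \<Rightarrow> ereal) set" where
  "Phi_family = {\<phi>. closed_proper_convex \<phi> \<and>
     {0..1} \<subseteq> interior (effective_domain \<phi>) \<and> \<phi> 1 = 1 \<and>
     (\<exists>!t. is_arg_min \<phi> (\<lambda>s. s \<in> {0..1}) t) \<and> \<phi> (t_star \<phi>) = 0}"

definition t_bar :: "(real \<Rightarrow> ereal) \<Rightarrow> real" where
  "t_bar \<phi> = (LEAST t. t \<in> {t_star \<phi>..<1} \<and> 1 / (1 - t_star \<phi>) \<in> subdifferential \<phi> t)"

text \<open>The subvector \<open>x\<^sub>J\<close> is extended by zero outside \<open>J\<close>, which changes neither its
  Euclidean norm nor whether it vanishes.\<close>

definition subvec :: "real ^ 'p \<Rightarrow> 'p::finite set \<Rightarrow> real ^ 'p" where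
  "subvec x J = (\<chi> j. if j \<in> J then x $ j else 0)"

definition group_norms :: "('m::finite \<Rightarrow> 'p::finite set) \<Rightarrow> real ^ 'p \<Rightarrow> real ^ 'm" where
  "group_norms J x = (\<chi> i. norm (subvec x (J i)))"

definition group_partition :: "('m::finite \<Rightarrow> 'p::finite set) \<Rightarrow> bool" where
  "group_partition J \<longleftrightarrow> disjoint_family J \<and> (\<Union>i. J i) = UNIV"

definition group_support :: "('m::finite \<Rightarrow> 'p::finite set) \<Rightarrow> real ^ 'p \<Rightarrow> 'm set" where
  "group_support J x = {i. subvec x (J i) \<noteq> 0}"

definition Omega :: "real \<Rightarrow> (real ^ 'p::finite) set" where
  "Omega R = {x. infnorm x \<le> R}"

definition least_squares :: "real ^ 'p::finite ^ 'n::finite \<Rightarrow> real ^ 'n \<Rightarrow> real ^ 'p \<Rightarrow> real" where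
  "least_squares A b x = 1 / (2 * real CARD('n)) * (norm (A *v x - b))\<^sup>2"

text \<open>The smallest Lipschitz constant of \<open>f\<close> on \<open>X\<close>.\<close>

definition lipschitz_constant :: "('a::metric_space \<Rightarrow> 'b::metric_space) \<Rightarrow> 'a set \<Rightarrow> real" where
  "lipschitz_constant f X = Inf {L. L-lipschitz_on X f}"

definition cone_set ::
  "(real \<Rightarrow> ereal) \<Rightarrow> ('m::finite \<Rightarrow> 'p::finite set) \<Rightarrow> 'm set \<Rightarrow> real \<Rightarrow> (real ^ 'p) set" where
  "cone_set \<phi> J Sbar l = {z. \<exists>S. Sbar \<subseteq> S \<and> real (card S) \<le> l \<and>
     (\<Sum>i\<in>- S. norm (subvec z (J i))) \<le> 2 / (1 - t_bar \<phi>) * (\<Sum>i\<in>S. norm (subvec z (J i)))}"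

definition RSC :: "real ^ 'p::finite ^ 'n::finite \<Rightarrow> real \<Rightarrow> (real ^ 'p) set \<Rightarrow> bool" where
  "RSC A \<kappa> C \<longleftrightarrow> \<kappa> > 0 \<and>
     (\<forall>x\<in>C. 1 / (2 * real CARD('n)) * (norm (A *v x))\<^sup>2 \<ge> \<kappa> * (norm x)\<^sup>2)"

definition rho_bar ::
  "(real \<Rightarrow> ereal) \<Rightarrow> real \<Rightarrow> real \<Rightarrow> real ^ 'p::finite ^ 'n::finite \<Rightarrow> real ^ 'n \<Rightarrow> real" where
  "rho_bar \<phi> \<nu> R A b = \<nu> * lipschitz_constant (least_squares A b) (Omega R) *
     ((1 - t_star \<phi>) * left_derivative \<phi> 1 / (1 - t_bar \<phi>))"

definition penalty_param :: "real \<Rightarrow> real \<Rightarrow> nat \<Rightarrow> real" where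
  "penalty_param \<nu> \<rho> k = (if k = 0 then inverse \<nu> else \<rho> * inverse \<nu>)"

text \<open>\<open>GEP_MSCRA \<phi> \<nu> \<rho> R J A b w x\<close>: the sequences \<open>w\<^sup>0, w\<^sup>1, \<dots>\<close> and \<open>x\<^sup>1, x\<^sup>2, \<dots>\<close> are a
  possible run of the algorithm; the minimizers need not be unique, and \<open>x 0\<close> is irrelevant.
  Nothing restricts how \<open>\<rho>\<close> depends on \<open>x\<^sup>1\<close>.\<close>

definition GEP_MSCRA ::
  "(real \<Rightarrow> ereal) \<Rightarrow> real \<Rightarrow> real \<Rightarrow> real \<Rightarrow> ('m::finite \<Rightarrow> 'p::finite set) \<Rightarrow>
   real ^ 'p ^ 'n::finite \<Rightarrow> real ^ 'n \<Rightarrow> (nat \<Rightarrow> real ^ 'm) \<Rightarrow> (nat \<Rightarrow> real ^ 'p) \<Rightarrow> bool" where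
  "GEP_MSCRA \<phi> \<nu> \<rho> R J A b w x \<longleftrightarrow>
     \<phi> \<in> Phi_family \<and> \<nu> > 0 \<and> \<rho> > rho_bar \<phi> \<nu> R A b \<and>
     (\<forall>i. 0 \<le> w 0 $ i \<and> w 0 $ i \<le> t_bar \<phi>) \<and>
     (\<forall>k\<ge>1. is_arg_min
        (\<lambda>y. least_squares A b y +
           penalty_param \<nu> \<rho> (k - 1) * (\<Sum>i\<in>UNIV. (1 - w (k - 1) $ i) * norm (subvec y (J i))))
        (\<lambda>y. y \<in> Omega R) (x k)) \<and>
     (\<forall>k\<ge>1. \<forall>i. is_arg_min
        (\<lambda>t. \<phi> t - ereal (\<rho> * t * norm (subvec (x k) (J i))))
        (\<lambda>t. t \<in> {0..1}) (w k $ i))"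

end

theory Submission
  imports Defs
begin

text \<open>Comparing the objective of the \<open>k\<close>-th subproblem at \<open>x\<^sup>k\<close> and at \<open>xbar\<close> gives
  \<open>\<parallel>A\<Delta>\<parallel>\<^sup>2 / 2n \<le> \<langle>\<epsilon>hat, \<Delta>\<rangle> + \<lambda> \<Sum>\<^sub>i (1 - w\<^sub>i) (\<parallel>xbar\<^sub>i\<parallel> - \<parallel>x\<^sup>k\<^sub>i\<parallel>)\<close> for the error
  \<open>\<Delta> = x\<^sup>k - xbar\<close>. Let \<open>S\<close> consist of the true support and of all groups whose weight exceeds
  \<open>t_bar\<close>. The bound on the noise then places \<open>\<Delta>\<close> in the cone attached to \<open>S\<close>, and restricted
  strong convexity bounds \<open>\<parallel>\<Delta>\<parallel>\<close> by a multiple of \<open>sqrt (card S)\<close>. A weight can exceed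
  \<open>t_bar\<close> only if \<open>\<rho> (1 - t_star) \<parallel>x\<^sup>k\<^sub>i\<parallel> \<ge> 1\<close>, so the number of such groups outside the true
  support is at most \<open>(\<rho> (1 - t_star) \<parallel>\<Delta>\<parallel>)\<^sup>2\<close>, which the restrictions on \<open>\<nu>\<close> and \<open>\<rho>\<close>
  keep below half the size of the true support. Hence \<open>card S\<close> stays below \<open>1.5 rbar\<close> and the
  argument iterates.\<close>

section \<open>Convex functions with values in the extended reals\<close>

text \<open>Convexity of the epigraph, read off as Jensen's inequality. Real upper bounds
  \<open>a\<close> and \<open>b\<close> stand in for the values of \<open>\<phi>\<close>, so no
  arithmetic with infinities occurs.\<close>

lemma closed_proper_convex_combination:
  assumes "closed_proper_convex \<phi>" "\<phi> s \<le> ereal a" "\<phi> t \<le> ereal b"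
    and "u \<ge> 0" "v \<ge> 0" "u + v = 1"
  shows "\<phi> (u * s + v * t) \<le> ereal (u * a + v * b)"
proof -
  have "convex (epigraph_ereal \<phi>)" "(s, a) \<in> epigraph_ereal \<phi>" "(t, b) \<in> epigraph_ereal \<phi>"
    using assms by (auto simp: closed_proper_convex_def epigraph_ereal_def)
  then have "u *\<^sub>R (s, a) + v *\<^sub>R (t, b) \<in> epigraph_ereal \<phi>"
    using assms(4-6) unfolding convex_def by blast
  then show ?thesis by (simp add: epigraph_ereal_def)
qed

lemma ereal_real_of_effective_domain:
  assumes "closed_proper_convex \<phi>" "t \<in> effective_domain \<phi>"
  shows "ereal (real_of_ereal (\<phi> t)) = \<phi> t"
  using assms by (cases "\<phi> t") (auto simp: closed_proper_convex_def effective_domain_def)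

lemma convex_effective_domain:
  assumes "closed_proper_convex \<phi>"
  shows "convex (effective_domain \<phi>)"
proof (rule convexI)
  fix s t u v :: real
  assume *: "s \<in> effective_domain \<phi>" "t \<in> effective_domain \<phi>" "0 \<le> u" "0 \<le> v" "u + v = 1"
  have "\<phi> (u * s + v * t) \<le> ereal (u * real_of_ereal (\<phi> s) + v * real_of_ereal (\<phi> t))"
    using closed_proper_convex_combination[OF assms _ _ *(3-5)]
      ereal_real_of_effective_domain[OF assms] *(1,2) by (metis order_refl)
  also have "\<dots> < \<infinity>" by simp
  finally show "u *\<^sub>R s + v *\<^sub>R t \<in> effective_domain \<phi>"
    by (simp add: effective_domain_def)
qed

lemma convex_on_effective_domain:
  assumes "closed_proper_convex \<phi>"
  shows "convex_on (effective_domain \<phi>) (\<lambda>t. real_of_ereal (\<phi> t))"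
  unfolding convex_on_def
proof (intro conjI convex_effective_domain[OF assms] ballI allI impI)
  fix s t u v :: real
  assume *: "s \<in> effective_domain \<phi>" "t \<in> effective_domain \<phi>" "0 \<le> u" "0 \<le> v" "u + v = 1"
  let ?c = "u * real_of_ereal (\<phi> s) + v * real_of_ereal (\<phi> t)"
  have "\<phi> (u * s + v * t) \<le> ereal ?c"
    using closed_proper_convex_combination[OF assms _ _ *(3-5)]
      ereal_real_of_effective_domain[OF assms] *(1,2) by (metis order_refl)
  moreover have "u * s + v * t \<in> effective_domain \<phi>"
    using convexD[OF convex_effective_domain[OF assms] *] by simp
  ultimately have "ereal (real_of_ereal (\<phi> (u * s + v * t))) \<le> ereal ?c"
    using ereal_real_of_effective_domain[OF assms] by simp
  then show "real_of_ereal (\<phi> (u *\<^sub>R s + v *\<^sub>R t)) \<le> ?c" by simp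
qed

text \<open>A smaller value at \<open>u\<close> would pull the chord from \<open>t\<close> to
  \<open>u\<close>, and with it \<open>f\<close>, below \<open>f t\<close> at points of
  \<open>{a..b}\<close> close to \<open>t\<close>.\<close>

lemma convex_on_local_min_global:
  fixes f :: "real \<Rightarrow> real"
  assumes f: "convex_on D f" and sub: "{a..b} \<subseteq> D" and t: "a < t" "t < b"
    and min: "\<And>s. s \<in> {a..b} \<Longrightarrow> f t \<le> f s" and u: "u \<in> D"
  shows "f t \<le> f u"
proof (rule ccontr)
  assume less: "\<not> f t \<le> f u"
  define d where "d = min (t - a) (b - t)"
  \<comment> \<open>This weight moves \<open>t\<close> towards \<open>u\<close> by at most
    \<open>d\<close>, wherever \<open>u\<close> lies, so the new point cannot leave
    \<open>{a..b}\<close>.\<close>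
  define \<theta> where "\<theta> = d / (d + \<bar>u - t\<bar>)"
  have d: "d > 0" using t by (simp add: d_def)
  have \<theta>: "0 < \<theta>" "\<theta> \<le> 1" using d by (auto simp: \<theta>_def divide_simps)
  have "\<theta> * \<bar>u - t\<bar> = \<bar>u - t\<bar> / (d + \<bar>u - t\<bar>) * d" by (simp add: \<theta>_def)
  also have "\<dots> \<le> 1 * d" using d by (intro mult_right_mono) (auto simp: divide_simps)
  finally have "\<bar>\<theta> * (u - t)\<bar> \<le> d" using \<theta> by (simp add: abs_mult)
  moreover have "(1 - \<theta>) * t + \<theta> * u = t + \<theta> * (u - t)" by (simp add: algebra_simps)
  ultimately have "(1 - \<theta>) * t + \<theta> * u \<in> {a..b}"
    unfolding d_def by (auto simp: abs_le_iff)
  then have "f t \<le> f ((1 - \<theta>) * t + \<theta> * u)" by (rule min)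
  also have "\<dots> \<le> (1 - \<theta>) * f t + \<theta> * f u"
  proof -
    have "t \<in> D" using sub t by auto
    then show ?thesis
      using convex_onD[OF f, of \<theta> t u] \<theta> u by simp
  qed
  also have "\<dots> < f t"
    using mult_strict_left_mono[of "f u" "f t" \<theta>] less \<theta> by (simp add: algebra_simps)
  finally show False by simp
qed

text \<open>A mean value theorem for convex functions without differentiability: subtracting the
  slope of the chord gives equal values at the ends, hence a minimizer strictly between them. By
  convexity it is global, which is a supporting line of slope \<open>s\<close>. It serves to show
  that \<open>t_bar\<close> exists.\<close>

lemma convex_on_chord_minorant_exists:
  fixes f :: "real \<Rightarrow> real"
  assumes f: "convex_on D f" and D: "{a..b} \<subseteq> D" and cont: "continuous_on {a..b} f"
    and "a < b" and chord: "f b = f a + s * (b - a)"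
  shows "\<exists>t\<in>{a..<b}. \<forall>u\<in>D. f t + s * (u - t) \<le> f u"
proof -
  define g where "g = (\<lambda>t. f t + - s * (t - a))"
  have lin: "convex_on D (\<lambda>t. - s * (t - a))"
    unfolding convex_on_def
  proof (intro conjI convex_on_imp_convex[OF f] ballI allI impI)
    fix x y u v :: real
    assume "u + v = 1"
    then have v: "v = 1 - u" by simp
    show "- s * (u *\<^sub>R x + v *\<^sub>R y - a) \<le> u * (- s * (x - a)) + v * (- s * (y - a))"
      unfolding v by (simp add: algebra_simps)
  qed
  have g: "convex_on D g" unfolding g_def by (rule convex_on_add[OF f lin])
  have ends: "g a = g b" using chord by (simp add: g_def algebra_simps)
  have "continuous_on {a..b} g" unfolding g_def by (intro continuous_intros cont)
  then obtain t0 where t0: "t0 \<in> {a..b}" "\<And>t. t \<in> {a..b} \<Longrightarrow> g t0 \<le> g t"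
    using continuous_attains_inf[of "{a..b}" g] \<open>a < b\<close> by auto
  have "\<exists>t. a < t \<and> t < b \<and> (\<forall>u\<in>{a..b}. g t \<le> g u)"
  proof (cases "a < t0 \<and> t0 < b")
    case True
    then show ?thesis using t0 by blast
  next
    case False
    \<comment> \<open>If the minimum is attained at an end, both ends attain it, and convexity
      carries it over to the midpoint.\<close>
    define m where "m = (a + b) / 2"
    have m: "a < m" "m < b" using \<open>a < b\<close> by (auto simp: m_def)
    from False t0 have "g t0 = g a" using ends by force
    moreover have "g m \<le> g a"
      using convex_onD[OF g, of "1/2" a b] D \<open>a < b\<close> ends
      by (auto simp: m_def add_divide_distrib subset_iff)
    ultimately show ?thesis using m t0 by (intro exI[of _ m]) fastforce
  qed
  then obtain t where t: "a < t" "t < b" "\<And>u. u \<in> {a..b} \<Longrightarrow> g t \<le> g u" by blast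
  have "f t + s * (u - t) \<le> f u" if "u \<in> D" for u
    using convex_on_local_min_global[OF g D t that] by (simp add: g_def algebra_simps)
  then show ?thesis using t by (intro bexI[of _ t]) auto
qed

text \<open>The difference quotients at \<open>x\<close> increase as \<open>s\<close> approaches
  \<open>x\<close> from the left, and the slope towards a point of \<open>D\<close> to the right of
  \<open>x\<close> bounds them. They therefore converge to their supremum, which dominates the
  quotient at \<open>a\<close>.\<close>

lemma convex_on_has_left_derivative:
  fixes f :: "real \<Rightarrow> real"
  assumes f: "convex_on D f" and x: "x \<in> interior D"
    and a: "a < x" "a \<in> D"
  obtains L where "(f has_real_derivative L) (at_left x)" "(f x - f a) / (x - a) \<le> L"
proof -
  define q where "q = (\<lambda>s. (f s - f x) / (s - x))"
  define I where "I = {a..<x}"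
  have xD: "x \<in> D" using x interior_subset by blast
  have conv: "convex D" using convex_on_imp_convex[OF f] .
  have ID: "{a..x} \<subseteq> D"
    using closed_segment_subset[OF a(2) xD conv] a(1) by (simp add: closed_segment_eq_real_ivl)
  obtain e where e: "e > 0" "cball x e \<subseteq> D" using x by (meson mem_interior_cball)
  have y: "x + e \<in> D" using e by (auto simp: subset_iff dist_real_def)
  have q_eq: "q s = (f x - f s) / (x - s)" for s
    unfolding q_def by (metis minus_diff_eq minus_divide_divide)
  have mono: "q s \<le> q t" if "s \<in> I" "t \<in> I" "s \<le> t" for s t
  proof (cases "s = t")
    case False
    then show ?thesis
      using convex_on_slope_le(2)[OF f, of s x t] that xD ID unfolding q_def I_def
      by (auto simp: subset_iff)
  qed simp
  have bound: "q s \<le> (f (x + e) - f x) / e" if "s \<in> I" for s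
  proof -
    have "s \<in> D" "s < x" using that ID by (auto simp: I_def subset_iff)
    then have "(f s - f x) / (s - x) \<le> (f x - f (x + e)) / (x - (x + e))"
      using convex_on_slope_le[OF f, of s "x + e" x] y e
      by (smt (verit) divide_minus_left divide_minus_right)
    then show ?thesis by (simp add: q_def diff_divide_distrib)
  qed
  define L where "L = Sup (q ` ({..<x} \<inter> I))"
  have "(q \<longlongrightarrow> L) (at x within ({..<x} \<inter> I))"
    unfolding L_def by (rule Lim_left_bound) (use mono bound in auto)
  moreover have "at x within ({..<x} \<inter> I) = at_left x"
    by (rule at_within_nhd[of _ "{a<..}"]) (use a in \<open>auto simp: I_def\<close>)
  ultimately have lim: "(q \<longlongrightarrow> L) (at_left x)" by simp
  then have "(f has_real_derivative L) (at_left x)"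
    by (simp add: has_field_derivative_iff q_def)
  moreover have "q a \<le> L"
    unfolding L_def
  proof (rule cSup_upper)
    show "bdd_above (q ` ({..<x} \<inter> I))"
      by (rule bdd_aboveI2[of _ _ "(f (x + e) - f x) / e"]) (auto intro: bound)
  qed (use a in \<open>auto simp: I_def\<close>)
  ultimately show ?thesis using that q_eq by simp
qed

section \<open>The family of penalty functions\<close>

lemma t_star_props:
  assumes "\<phi> \<in> Phi_family"
  shows "\<phi> (t_star \<phi>) = 0" "0 \<le> t_star \<phi>" "t_star \<phi> < 1"
proof -
  have "is_arg_min \<phi> (\<lambda>s. s \<in> {0..1}) (t_star \<phi>)"
    using assms unfolding t_star_def Phi_family_def by (auto intro: theI')
  moreover have "\<phi> 1 = 1" and z: "\<phi> (t_star \<phi>) = 0" using assms by (auto simp: Phi_family_def)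
  ultimately show "0 \<le> t_star \<phi>" "t_star \<phi> < 1" "\<phi> (t_star \<phi>) = 0"
    by (auto simp: is_arg_min_def order.strict_iff_order)
qed

lemma Phi_family_domain:
  assumes "\<phi> \<in> Phi_family"
  shows "closed_proper_convex \<phi>" "{0..1} \<subseteq> interior (effective_domain \<phi>)"
    "{0..1} \<subseteq> effective_domain \<phi>"
  using assms interior_subset[of "effective_domain \<phi>"] by (auto simp: Phi_family_def)

lemma Phi_family_real:
  assumes "\<phi> \<in> Phi_family"
  shows "t \<in> {0..1} \<Longrightarrow> ereal (real_of_ereal (\<phi> t)) = \<phi> t"
  using ereal_real_of_effective_domain Phi_family_domain[OF assms] by blast

text \<open>The number \<open>1 / (1 - t_star \<phi>)\<close> is the slope of the chord from
  \<open>(t_star \<phi>, 0)\<close> to \<open>(1, 1)\<close>.\<close>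

lemma Phi_family_chord_subgradient:
  assumes \<phi>: "\<phi> \<in> Phi_family"
  shows "\<exists>t\<in>{t_star \<phi>..<1}. 1 / (1 - t_star \<phi>) \<in> subdifferential \<phi> t"
proof -
  define f where "f = (\<lambda>t. real_of_ereal (\<phi> t))"
  define a where "a = t_star \<phi>"
  define s where "s = 1 / (1 - a)"
  have a: "\<phi> a = 0" "0 \<le> a" "a < 1" using t_star_props[OF \<phi>] by (auto simp: a_def)
  have f: "convex_on (effective_domain \<phi>) f"
    unfolding f_def by (rule convex_on_effective_domain[OF Phi_family_domain(1)[OF \<phi>]])
  have "continuous_on (interior (effective_domain \<phi>)) f"
    using convex_on_subset[OF f interior_subset]
      convex_interior[OF convex_on_imp_convex[OF f]] 
    by (intro convex_on_continuous) auto
  then have cont: "continuous_on {a..1} f"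
    by (rule continuous_on_subset) (use Phi_family_domain(2)[OF \<phi>] a in auto)
  have D: "{a..1} \<subseteq> effective_domain \<phi>" using Phi_family_domain(3)[OF \<phi>] a by auto
  have "\<phi> 1 = 1" using \<phi> by (simp add: Phi_family_def)
  then have chord: "f 1 = f a + s * (1 - a)" using a by (simp add: f_def s_def)
  obtain t where t: "t \<in> {a..<1}" "\<And>u. u \<in> effective_domain \<phi> \<Longrightarrow> f t + s * (u - t) \<le> f u"
    using convex_on_chord_minorant_exists[OF f D cont a(3) chord] by blast
  have ft: "ereal (f t) = \<phi> t" using Phi_family_real[OF \<phi>, of t] t(1) a by (simp add: f_def)
  have "\<phi> t + ereal (s * (u - t)) \<le> \<phi> u" for u
  proof (cases "u \<in> effective_domain \<phi>")
    case True
    then have fu: "ereal (f u) = \<phi> u"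
      using ereal_real_of_effective_domain[OF Phi_family_domain(1)[OF \<phi>]] by (simp add: f_def)
    then show ?thesis using t(2)[OF True] by (simp flip: ft fu)
  qed (simp add: effective_domain_def)
  then have "s \<in> subdifferential \<phi> t" by (simp add: subdifferential_def)
  then show ?thesis using t(1) by (auto simp: a_def s_def)
qed

text \<open>Since \<open>t_bar\<close> is defined by \<open>LEAST\<close>, the minimum has to be
  shown to be attained. Points sharing the subgradient \<open>s\<close> lie on one supporting line,
  so the candidates form the part in \<open>{a..<1}\<close> of a closed contact set.\<close>

lemma t_bar_props:
  assumes \<phi>: "\<phi> \<in> Phi_family"
  shows "t_star \<phi> \<le> t_bar \<phi>" "t_bar \<phi> < 1"
    "1 / (1 - t_star \<phi>) \<in> subdifferential \<phi> (t_bar \<phi>)"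
proof -
  define a where "a = t_star \<phi>"
  define s where "s = 1 / (1 - a)"
  define T where "T = {t. t \<in> {a..<1} \<and> s \<in> subdifferential \<phi> t}"
  have a: "0 \<le> a" "a < 1" using t_star_props[OF \<phi>] by (auto simp: a_def)
  obtain t0 where t0: "t0 \<in> T"
    using Phi_family_chord_subgradient[OF \<phi>] by (auto simp: T_def a_def s_def)
  have r: "ereal (real_of_ereal (\<phi> t)) = \<phi> t" if "t \<in> T" for t
    using Phi_family_real[OF \<phi>, of t] that a by (auto simp: T_def)
  have sub: "\<phi> t + ereal (s * (u - t)) \<le> \<phi> u" if "t \<in> T" for t u
    using that by (auto simp: T_def subdifferential_def)
  \<comment> \<open>The supporting line of slope \<open>s\<close> at \<open>t0\<close>. As it
    minorizes \<open>\<phi>\<close>, the set \<open>K\<close> below is where the two agree; it is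
    closed as a preimage of the epigraph.\<close>
  define h where "h = (\<lambda>t. real_of_ereal (\<phi> t0) + s * (t - t0))"
  define K where "K = {t. \<phi> t \<le> ereal (h t)}"
  have "K = (\<lambda>t. (t, h t)) -` epigraph_ereal \<phi>"
    by (auto simp: K_def epigraph_ereal_def)
  moreover have "closed (epigraph_ereal \<phi>)"
    using Phi_family_domain(1)[OF \<phi>] by (simp add: closed_proper_convex_def)
  ultimately have "closed K"
    unfolding h_def by (auto intro!: continuous_closed_vimage continuous_intros)
  have T_K: "t \<in> T \<longleftrightarrow> t \<in> {a..<1} \<and> t \<in> K" for t
  proof (intro iffI conjI)
    assume t: "t \<in> T"
    show "t \<in> {a..<1}" using t by (simp add: T_def)
    have "\<phi> t + ereal (s * (t0 - t)) \<le> \<phi> t0" by (rule sub[OF t])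
    then have "ereal (real_of_ereal (\<phi> t) + s * (t0 - t)) \<le> ereal (real_of_ereal (\<phi> t0))"
      using r[OF t] r[OF t0] by (metis plus_ereal.simps(1))
    then have "ereal (real_of_ereal (\<phi> t)) \<le> ereal (h t)" by (simp add: h_def algebra_simps)
    then show "t \<in> K" using r[OF t] by (simp add: K_def)
  next
    assume t: "t \<in> {a..<1} \<and> t \<in> K"
    have "\<phi> t + ereal (s * (u - t)) \<le> \<phi> u" for u
    proof -
      have "\<phi> t + ereal (s * (u - t)) \<le> ereal (h t) + ereal (s * (u - t))"
        using t by (intro add_right_mono) (simp add: K_def)
      also have "\<dots> = ereal (real_of_ereal (\<phi> t0)) + ereal (s * (u - t0))"
        by (simp add: h_def algebra_simps)
      also have "\<dots> = \<phi> t0 + ereal (s * (u - t0))" by (simp only: r[OF t0])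
      also have "\<dots> \<le> \<phi> u" by (rule sub[OF t0])
      finally show ?thesis .
    qed
    then show "t \<in> T" using t by (simp add: T_def subdifferential_def)
  qed
  \<comment> \<open>The interval \<open>{a..<1}\<close> is not compact. Cutting it at the known
    candidate \<open>t0\<close> makes it so and loses no candidate smaller than
    \<open>t0\<close>.\<close>
  have "t0 \<in> {a..t0} \<inter> K" using t0 T_K by auto
  moreover have "compact ({a..t0} \<inter> K)" using \<open>closed K\<close> by (intro compact_Int_closed) auto
  ultimately obtain t where t: "t \<in> {a..t0} \<inter> K" "\<And>u. u \<in> {a..t0} \<inter> K \<Longrightarrow> t \<le> u"
    using compact_attains_inf[of "{a..t0} \<inter> K"] by blast
  have tT: "t \<in> T" using t(1) t0 T_K by auto
  have min: "t \<le> u" if "u \<in> T" for u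
    using t t0 T_K that by (cases "u \<le> t0") auto
  have "t_bar \<phi> = t"
    unfolding t_bar_def a_def[symmetric] s_def[symmetric]
    by (rule Least_equality) (use tT min in \<open>auto simp: T_def\<close>)
  then show "t_star \<phi> \<le> t_bar \<phi>" "t_bar \<phi> < 1"
    "1 / (1 - t_star \<phi>) \<in> subdifferential \<phi> (t_bar \<phi>)"
    using tT by (auto simp: T_def a_def s_def)
qed

text \<open>The left derivative at 1 is at least the slope of the chord from
  \<open>t_star \<phi>\<close>, which is positive. This sign is what makes \<open>rho_bar\<close>
  nonnegative and hence \<open>\<rho>\<close> positive.\<close>

lemma left_derivative_nonneg:
  assumes \<phi>: "\<phi> \<in> Phi_family"
  shows "0 \<le> left_derivative \<phi> 1"
proof -
  define f where "f = (\<lambda>t. real_of_ereal (\<phi> t))"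
  have f: "convex_on (effective_domain \<phi>) f"
    unfolding f_def by (rule convex_on_effective_domain[OF Phi_family_domain(1)[OF \<phi>]])
  have "1 \<in> interior (effective_domain \<phi>)" "t_star \<phi> \<in> effective_domain \<phi>"
    using Phi_family_domain[OF \<phi>] t_star_props[OF \<phi>] by auto
  then obtain L where L: "(f has_real_derivative L) (at_left 1)"
      "(f 1 - f (t_star \<phi>)) / (1 - t_star \<phi>) \<le> L"
    using convex_on_has_left_derivative[OF f _ t_star_props(3)[OF \<phi>]] by blast
  \<comment> \<open>The definition uses \<open>THE\<close>, so uniqueness of the one-sided limit is
    required as well.\<close>
  have "left_derivative \<phi> 1 = L"
  proof -
    have "left_derivative \<phi> 1 = (THE D. (f has_real_derivative D) (at_left 1))"
      by (simp add: left_derivative_def f_def)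
    also have "\<dots> = L"
    proof (rule the_equality)
      show "(f has_real_derivative L) (at_left 1)" by (rule L(1))
    next
      fix D assume "(f has_real_derivative D) (at_left 1)"
      with L(1) show "D = L"
        unfolding has_field_derivative_iff
        by (intro tendsto_unique[of "at_left (1::real)"]) auto
    qed
    finally show ?thesis .
  qed
  moreover have "f 1 = 1" "f (t_star \<phi>) = 0"
    using \<phi> by (auto simp: f_def Phi_family_def)
  ultimately have "1 / (1 - t_star \<phi>) \<le> left_derivative \<phi> 1" using L(2) by simp
  moreover have "0 \<le> 1 / (1 - t_star \<phi>)" using t_star_props(3)[OF \<phi>] by simp
  ultimately show ?thesis by (rule order_trans[rotated])
qed

text \<open>Comparing the minimizer \<open>v\<close> with the competitor \<open>t_bar \<phi>\<close>
  bounds the growth of \<open>\<phi>\<close> between them by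
  \<open>\<rho> * N * (v - t_bar \<phi>)\<close>. The subgradient at \<open>t_bar \<phi>\<close>
  bounds it below by \<open>(v - t_bar \<phi>) / (1 - t_star \<phi>)\<close>; then divide by the
  positive difference.\<close>

lemma weight_above_t_bar:
  assumes \<phi>: "\<phi> \<in> Phi_family"
    and min: "is_arg_min (\<lambda>t. \<phi> t - ereal (\<rho> * t * N)) (\<lambda>t. t \<in> {0..1}) v"
    and v: "v > t_bar \<phi>"
  shows "1 \<le> (1 - t_star \<phi>) * (\<rho> * N)"
proof -
  define a where "a = t_star \<phi>"
  define c where "c = t_bar \<phi>"
  define f where "f = (\<lambda>t. real_of_ereal (\<phi> t))"
  have a: "0 \<le> a" "a < 1" "a \<le> c" "c < 1"
    using t_star_props[OF \<phi>] t_bar_props[OF \<phi>] by (auto simp: a_def c_def)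
  have vI: "v \<in> {0..1}" and cI: "c \<in> {0..1}" using min a by (auto simp: is_arg_min_def)
  have r: "\<phi> v = ereal (f v)" "\<phi> c = ereal (f c)"
    using Phi_family_real[OF \<phi>] vI cI by (auto simp: f_def)
  have "\<not> \<phi> c - ereal (\<rho> * c * N) < \<phi> v - ereal (\<rho> * v * N)"
    using min cI by (auto simp: is_arg_min_def)
  then have 1: "f v - \<rho> * v * N \<le> f c - \<rho> * c * N" by (simp add: r)
  have "\<phi> c + ereal (1 / (1 - a) * (v - c)) \<le> \<phi> v"
    using t_bar_props(3)[OF \<phi>] by (simp add: subdifferential_def a_def c_def)
  then have "f c + 1 / (1 - a) * (v - c) \<le> f v" by (simp add: r)
  with 1 have 2: "1 / (1 - a) * (v - c) \<le> (\<rho> * N) * (v - c)" by (simp add: algebra_simps)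
  have "1 / (1 - a) \<le> \<rho> * N"
    by (rule mult_right_le_imp_le[OF 2]) (use v in \<open>simp add: c_def\<close>)
  then show ?thesis using a by (simp add: a_def[symmetric] pos_divide_le_eq mult.commute)
qed

section \<open>Group norms and the least squares loss\<close>

lemma sum_group_partition:
  fixes J :: "'m::finite \<Rightarrow> 'p::finite set" and g :: "'p \<Rightarrow> real"
  assumes "group_partition J"
  shows "(\<Sum>i\<in>UNIV. \<Sum>j\<in>J i. g j) = (\<Sum>j\<in>UNIV. g j)"
proof -
  have "(\<Sum>j\<in>(\<Union>i. J i). g j) = (\<Sum>i\<in>UNIV. \<Sum>j\<in>J i. g j)"
    using assms by (intro sum.UNION_disjoint) (auto simp: group_partition_def disjoint_family_on_def)
  then show ?thesis using assms by (simp add: group_partition_def)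
qed

lemma inner_subvec: "subvec x K \<bullet> subvec y K = (\<Sum>j\<in>K. x $ j * y $ j)"
  by (auto simp: inner_vec_def subvec_def if_distrib sum.If_cases cong: if_cong)

lemma inner_eq_sum_subvec:
  assumes "group_partition J"
  shows "x \<bullet> y = (\<Sum>i\<in>UNIV. subvec x (J i) \<bullet> subvec y (J i))"
proof -
  have "x \<bullet> y = (\<Sum>j\<in>UNIV. x $ j * y $ j)" by (simp add: inner_vec_def)
  then show ?thesis by (simp add: inner_subvec sum_group_partition[OF assms])
qed

lemma norm_power2_eq_sum_subvec:
  assumes "group_partition J"
  shows "(norm x)\<^sup>2 = (\<Sum>i\<in>UNIV. (norm (subvec x (J i)))\<^sup>2)"
  unfolding power2_norm_eq_inner by (rule inner_eq_sum_subvec[OF assms])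

lemma subvec_diff: "subvec (x - y) K = subvec x K - subvec y K"
  by (auto simp: subvec_def vec_eq_iff)

text \<open>Cauchy-Schwarz in each group: the maximum of the group norms is dual to their
  sum.\<close>

lemma inner_le_group_norms:
  assumes "group_partition J"
  shows "x \<bullet> y \<le> infnorm (group_norms J x) * (\<Sum>i\<in>UNIV. norm (subvec y (J i)))"
proof -
  have "subvec x (J i) \<bullet> subvec y (J i) \<le> infnorm (group_norms J x) * norm (subvec y (J i))" for i
  proof -
    have "norm (subvec x (J i)) \<le> infnorm (group_norms J x)"
      using component_le_infnorm_cart[of "group_norms J x" i] by (simp add: group_norms_def)
    then show ?thesis
      using norm_cauchy_schwarz[of "subvec x (J i)" "subvec y (J i)"]
      by (meson mult_right_mono norm_ge_zero order_trans)
  qed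
  then show ?thesis
    by (subst inner_eq_sum_subvec[OF assms]) (simp add: sum_distrib_left sum_mono)
qed

lemma sum_le_sqrt_card_norm:
  assumes "group_partition J"
  shows "(\<Sum>i\<in>S. norm (subvec x (J i))) \<le> sqrt (real (card S)) * norm x"
proof -
  have "(\<Sum>i\<in>S. norm (subvec x (J i)))\<^sup>2 \<le> real (card S) * (\<Sum>i\<in>S. (norm (subvec x (J i)))\<^sup>2)"
    using sum_squared_le_sum_of_squares[of "\<lambda>i. norm (subvec x (J i))" S] 
    by (simp add: mult.commute)
  also have "\<dots> \<le> real (card S) * (norm x)\<^sup>2"
    by (subst norm_power2_eq_sum_subvec[OF assms, of x]) (intro mult_left_mono sum_mono2, auto)
  finally show ?thesis
    by (rule power2_le_imp_le[OF ord_le_eq_trans]) (auto simp: power_mult_distrib)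
qed

text \<open>Residuals are bounded on the bounded set \<open>Omega R\<close>, and
  \<open>u\<^sup>2 - v\<^sup>2 = (u - v) * (u + v)\<close> for two residual norms.\<close>

lemma least_squares_lipschitz:
  fixes A :: "real ^ 'p::finite ^ 'n::finite"
  shows "\<exists>L. L-lipschitz_on (Omega R) (least_squares A b)"
proof -
  obtain K where K: "K > 0" "\<And>x. norm (A *v x) \<le> norm x * K"
    using bounded_linear.pos_bounded[OF matrix_vector_mul_bounded_linear[of A]] by blast
  define M where "M = sqrt (real CARD('p)) * \<bar>R\<bar> * K + norm b"
  have M: "norm (A *v x - b) \<le> M" if "x \<in> Omega R" for x
  proof -
    have "norm x \<le> sqrt (real CARD('p)) * infnorm x" using norm_le_infnorm[of x] by simp
    also have "\<dots> \<le> sqrt (real CARD('p)) * \<bar>R\<bar>"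
      using that by (intro mult_left_mono) (auto simp: Omega_def)
    finally have "norm x * K \<le> sqrt (real CARD('p)) * \<bar>R\<bar> * K" using K by simp
    then show ?thesis
      using K(2)[of x] norm_triangle_ineq4[of "A *v x" b] by (simp add: M_def)
  qed
  have M0: "M \<ge> 0" using K by (simp add: M_def)
  define c where "c = 1 / (2 * real CARD('n))"
  have c: "c > 0" by (simp add: c_def)
  have "(c * (K * (2 * M)))-lipschitz_on (Omega R) (least_squares A b)"
  proof (rule lipschitz_onI)
    fix x y :: "real ^ 'p"
    assume xy: "x \<in> Omega R" "y \<in> Omega R"
    define u where "u = norm (A *v x - b)"
    define v where "v = norm (A *v y - b)"
    have "\<bar>u - v\<bar> \<le> norm ((A *v x - b) - (A *v y - b))"
      unfolding u_def v_def by (rule norm_triangle_ineq3)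
    also have "\<dots> = norm (A *v (x - y))" by (simp add: matrix_vector_mult_diff_distrib)
    also have "\<dots> \<le> K * dist x y" using K(2)[of "x - y"] by (simp add: dist_norm mult.commute)
    finally have 1: "\<bar>u - v\<bar> \<le> K * dist x y" .
    have 2: "\<bar>u + v\<bar> \<le> 2 * M" using M[OF xy(1)] M[OF xy(2)] by (simp add: u_def v_def)
    have "\<bar>u\<^sup>2 - v\<^sup>2\<bar> = \<bar>u - v\<bar> * \<bar>u + v\<bar>"
      by (simp add: abs_mult[symmetric] power2_eq_square algebra_simps)
    also have "\<dots> \<le> (K * dist x y) * (2 * M)" using 1 2 K by (intro mult_mono) auto
    finally have "c * \<bar>u\<^sup>2 - v\<^sup>2\<bar> \<le> c * ((K * dist x y) * (2 * M))" using c by simp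
    moreover have "dist (least_squares A b x) (least_squares A b y) = c * \<bar>u\<^sup>2 - v\<^sup>2\<bar>"
      using c by (simp add: least_squares_def c_def[symmetric] u_def[symmetric] v_def[symmetric]
          dist_real_def abs_mult flip: right_diff_distrib)
    ultimately show "dist (least_squares A b x) (least_squares A b y) \<le> c * (K * (2 * M)) * dist x y"
      by (simp add: mult_ac)
  qed (use c K M0 in auto)
  then show ?thesis by blast
qed

text \<open>The assumption ensures that the infimum is taken over a nonempty set; \<open>Inf\<close>
  of the empty set of reals carries no information.\<close>

lemma lipschitz_constant_nonneg:
  assumes "\<exists>L. L-lipschitz_on X f"
  shows "0 \<le> lipschitz_constant f X"
  unfolding lipschitz_constant_def
  by (rule cInf_greatest) (use assms lipschitz_on_nonneg in auto)

lemma rho_bar_nonneg: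
  assumes \<phi>: "\<phi> \<in> Phi_family" and "\<nu> > 0"
  shows "0 \<le> rho_bar \<phi> \<nu> R A b"
  using assms t_star_props[OF \<phi>] t_bar_props[OF \<phi>] left_derivative_nonneg[OF \<phi>]
    lipschitz_constant_nonneg[OF least_squares_lipschitz[of R A b]]
  by (simp add: rho_bar_def)

section \<open>Error analysis of a single weighted subproblem\<close>

lemma least_squares_diff:
  fixes A :: "real ^ 'p::finite ^ 'n::finite"
  assumes b: "b = A *v z + \<epsilon>"
  shows "least_squares A b x - least_squares A b z
    = 1 / (2 * real CARD('n)) * (norm (A *v (x - z)))\<^sup>2
      - ((1 / real CARD('n)) *\<^sub>R (transpose A *v \<epsilon>)) \<bullet> (x - z)"
proof -
  define u where "u = A *v (x - z)"
  have 1: "A *v x - b = u - \<epsilon>" and 2: "A *v z - b = - \<epsilon>"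
    using b by (auto simp: u_def matrix_vector_mult_diff_distrib)
  have 3: "(transpose A *v \<epsilon>) \<bullet> (x - z) = \<epsilon> \<bullet> u"
    unfolding u_def using dot_lmul_matrix[of \<epsilon> A "x - z"] by simp
  show ?thesis
    unfolding least_squares_def 1 2 inner_scaleR_left 3 u_def[symmetric]
    by (simp add: power2_norm_eq_inner inner_diff field_simps inner_commute)
qed

text \<open>Optimality of \<open>x\<close> against \<open>z\<close> is split into groups. Noise and
  penalty together contribute at most \<open>(\<eta> + \<mu>) * N i\<close> inside \<open>S\<close>
  and at most \<open>(\<eta> - \<mu> * (1 - a)) * N i\<close> outside, where \<open>z\<close>
  vanishes and the weights are at least \<open>1 - a\<close>.\<close>

lemma subproblem_estimate:
  fixes A :: "real ^ 'p::finite ^ 'n::finite" and J :: "'m::finite \<Rightarrow> 'p set" and v :: "'m \<Rightarrow> real"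
  assumes J: "group_partition J" and b: "b = A *v z + \<epsilon>" and z: "z \<in> X"
    and min: "is_arg_min (\<lambda>y. least_squares A b y + \<mu> * (\<Sum>i\<in>UNIV. v i * norm (subvec y (J i))))
                (\<lambda>y. y \<in> X) x"
    and \<mu>: "\<mu> > 0" and a: "a < 1"
    and v: "\<And>i. 0 \<le> v i" "\<And>i. v i \<le> 1"
    and S: "group_support J z \<subseteq> S" "\<And>i. i \<notin> S \<Longrightarrow> 1 - a \<le> v i"
    and noise: "infnorm (group_norms J ((1 / real CARD('n)) *\<^sub>R (transpose A *v \<epsilon>)))
                  \<le> \<mu> * (1 - a) / (3 - a)"
  shows "1 / (2 * real CARD('n)) * (norm (A *v (x - z)))\<^sup>2
           + \<mu> * ((4 - 2 * a) / (3 - a)) * ((1 - a) / 2) * (\<Sum>i\<in>- S. norm (subvec (x - z) (J i)))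
         \<le> \<mu> * ((4 - 2 * a) / (3 - a)) * (\<Sum>i\<in>S. norm (subvec (x - z) (J i)))"
proof -
  define \<epsilon>' where "\<epsilon>' = (1 / real CARD('n)) *\<^sub>R (transpose A *v \<epsilon>)"
  define \<eta> where "\<eta> = infnorm (group_norms J \<epsilon>')"
  define q where "q = (4 - 2 * a) / (3 - a)"
  define N where "N = (\<lambda>i. norm (subvec (x - z) (J i)))"
  let ?h = "\<lambda>y. \<Sum>i\<in>UNIV. v i * norm (subvec y (J i))"
  have \<eta>: "\<eta> \<le> \<mu> * (1 - a) / (3 - a)" using noise by (simp add: \<eta>_def \<epsilon>'_def)
  \<comment> \<open>Both this bound and the next are equalities at the largest admissible noise
    level. Their ratio is the cone constant \<open>2 / (1 - a)\<close>.\<close>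
  have q1: "\<eta> + \<mu> \<le> \<mu> * q" using \<eta> a by (simp add: q_def field_simps)
  have q2: "\<eta> - \<mu> * (1 - a) \<le> - (\<mu> * q * ((1 - a) / 2))"
    using \<eta> a by (simp add: q_def field_simps)
  have opt: "least_squares A b x + \<mu> * ?h x \<le> least_squares A b z + \<mu> * ?h z"
    using min z by (force simp: is_arg_min_def)
  have N0: "N i \<ge> 0" for i by (simp add: N_def)
  have comp: "\<eta> * N i + \<mu> * (v i * norm (subvec z (J i)) - v i * norm (subvec x (J i)))
      \<le> (if i \<in> S then \<mu> * q * N i else - (\<mu> * q * ((1 - a) / 2) * N i))" for i
  proof (cases "i \<in> S")
    case True
    have "norm (subvec z (J i)) - norm (subvec x (J i)) \<le> N i"
      unfolding N_def subvec_diff by (metis norm_minus_commute norm_triangle_ineq2)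
    then have "v i * (norm (subvec z (J i)) - norm (subvec x (J i))) \<le> v i * N i"
      using v by (intro mult_left_mono) auto
    also have "\<dots> \<le> 1 * N i" using v N0 by (intro mult_right_mono) auto
    finally have "\<mu> * (v i * norm (subvec z (J i)) - v i * norm (subvec x (J i))) \<le> \<mu> * N i"
      using \<mu> by (intro mult_left_mono) (simp_all add: right_diff_distrib)
    moreover have "(\<eta> + \<mu>) * N i \<le> \<mu> * q * N i" using q1 N0 by (intro mult_right_mono) auto
    ultimately show ?thesis using True by (simp add: algebra_simps)
  next
    case False
    then have "subvec z (J i) = 0" using S by (auto simp: group_support_def)
    then have "norm (subvec z (J i)) = 0" "norm (subvec x (J i)) = N i"
      by (auto simp: N_def subvec_diff)
    moreover have "\<mu> * (1 - a) * N i \<le> \<mu> * v i * N i"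
      using S(2)[OF False] \<mu> N0 by (intro mult_right_mono mult_left_mono) auto
    moreover have "(\<eta> - \<mu> * (1 - a)) * N i \<le> - (\<mu> * q * ((1 - a) / 2)) * N i"
      using q2 N0 by (intro mult_right_mono) auto
    ultimately show ?thesis using False by (simp add: left_diff_distrib mult.assoc)
  qed
  have "1 / (2 * real CARD('n)) * (norm (A *v (x - z)))\<^sup>2 \<le> \<epsilon>' \<bullet> (x - z) + \<mu> * (?h z - ?h x)"
    using least_squares_diff[OF b, of x] opt by (simp add: \<epsilon>'_def algebra_simps)
  also have "\<dots> \<le> \<eta> * (\<Sum>i\<in>UNIV. N i) + \<mu> * (?h z - ?h x)"
    using inner_le_group_norms[OF J, of \<epsilon>' "x - z"] by (simp add: \<eta>_def N_def)
  also have "\<dots> = (\<Sum>i\<in>UNIV. \<eta> * N i + \<mu> * (v i * norm (subvec z (J i)) - v i * norm (subvec x (J i))))"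
    by (simp add: sum.distrib sum_subtractf flip: sum_distrib_left)
  also have "\<dots> \<le> (\<Sum>i\<in>UNIV. if i \<in> S then \<mu> * q * N i else - (\<mu> * q * ((1 - a) / 2) * N i))"
    by (intro sum_mono comp)
  also have "\<dots> = \<mu> * q * (\<Sum>i\<in>S. N i) - \<mu> * q * ((1 - a) / 2) * (\<Sum>i\<in>- S. N i)"
    by (simp add: sum.If_cases sum_negf sum_distrib_left Collect_neg_eq[symmetric])
  finally show ?thesis by (simp add: q_def N_def)
qed

text \<open>The preceding estimate is used twice: without the quadratic term it puts
  \<open>x - z\<close> in the cone, and without the sum over \<open>- S\<close> it bounds the
  quadratic term from above. Restricted strong convexity bounds that term from below.\<close>

lemma subproblem_error_bound:
  fixes A :: "real ^ 'p::finite ^ 'n::finite" and J :: "'m::finite \<Rightarrow> 'p set" and v :: "'m \<Rightarrow> real"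
  assumes J: "group_partition J" and b: "b = A *v z + \<epsilon>" and z: "z \<in> X"
    and min: "is_arg_min (\<lambda>y. least_squares A b y + \<mu> * (\<Sum>i\<in>UNIV. v i * norm (subvec y (J i))))
                (\<lambda>y. y \<in> X) x"
    and \<mu>: "\<mu> > 0" and a: "a = t_bar \<phi>" "a < 1"
    and v: "\<And>i. 0 \<le> v i" "\<And>i. v i \<le> 1"
    and S: "group_support J z \<subseteq> S" "\<And>i. i \<notin> S \<Longrightarrow> 1 - a \<le> v i"
    and noise: "infnorm (group_norms J ((1 / real CARD('n)) *\<^sub>R (transpose A *v \<epsilon>)))
                  \<le> \<mu> * (1 - a) / (3 - a)"
    and rsc: "RSC A \<kappa> (cone_set \<phi> J (group_support J z) l)" and card: "real (card S) \<le> l"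
  shows "norm (x - z) \<le> \<mu> * ((4 - 2 * a) / (\<kappa> * (3 - a))) * sqrt l"
proof -
  define q where "q = (4 - 2 * a) / (3 - a)"
  define P where "P = (\<Sum>i\<in>S. norm (subvec (x - z) (J i)))"
  define Q where "Q = (\<Sum>i\<in>- S. norm (subvec (x - z) (J i)))"
  define F where "F = 1 / (2 * real CARD('n)) * (norm (A *v (x - z)))\<^sup>2"
  have est: "F + \<mu> * q * ((1 - a) / 2) * Q \<le> \<mu> * q * P"
    unfolding F_def q_def Q_def P_def
    by (rule subproblem_estimate[OF J b z min \<mu> a(2) v S noise])
  have q: "q > 0" using a by (simp add: q_def)
  have \<kappa>: "\<kappa> > 0" using rsc by (simp add: RSC_def)
  have pos: "F \<ge> 0" "Q \<ge> 0" by (auto simp: F_def Q_def intro: sum_nonneg)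
  have "\<mu> * q * ((1 - a) / 2 * Q) \<le> \<mu> * q * P" using est pos by (simp add: mult.assoc)
  then have "(1 - a) / 2 * Q \<le> P" using \<mu> q by simp
  then have "Q \<le> 2 / (1 - a) * P" using a(2) by (simp add: field_simps)
  then have "x - z \<in> cone_set \<phi> J (group_support J z) l"
    using S card unfolding cone_set_def P_def Q_def a(1) by blast
  then have "\<kappa> * (norm (x - z))\<^sup>2 \<le> F" using rsc by (simp add: RSC_def F_def)
  also have "F \<le> \<mu> * q * P"
  proof -
    have "0 \<le> \<mu> * q * ((1 - a) / 2) * Q" using \<mu> q a(2) pos by simp
    then show ?thesis using est by linarith
  qed
  also have "\<dots> \<le> \<mu> * q * (sqrt l * norm (x - z))"
  proof -
    have "P \<le> sqrt (real (card S)) * norm (x - z)"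
      unfolding P_def by (rule sum_le_sqrt_card_norm[OF J])
    also have "\<dots> \<le> sqrt l * norm (x - z)" using card by (intro mult_right_mono) auto
    finally show ?thesis using \<mu> q by simp
  qed
  finally have *: "(\<kappa> * norm (x - z)) * norm (x - z) \<le> (\<mu> * q * sqrt l) * norm (x - z)"
    by (simp add: power2_eq_square mult_ac)
  have l: "0 \<le> l" using card by linarith
  have "\<kappa> * norm (x - z) \<le> \<mu> * q * sqrt l"
  proof (cases "norm (x - z) = 0")
    case True
    then show ?thesis using \<mu> q l by simp
  next
    case False
    then show ?thesis by (intro mult_right_le_imp_le[OF *]) simp
  qed
  then have "norm (x - z) \<le> \<mu> * q * sqrt l / \<kappa>" using \<kappa> by (simp add: field_simps)
  then show ?thesis by (simp add: q_def mult.commute)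
qed

text \<open>As \<open>z\<close> vanishes on these groups, each of them contributes at least 1 to
  \<open>c\<^sup>2 * (norm (x - z))\<^sup>2\<close>.\<close>

lemma card_large_groups:
  assumes J: "group_partition J" and z: "\<And>i. i \<in> T \<Longrightarrow> subvec z (J i) = 0"
    and large: "\<And>i. i \<in> T \<Longrightarrow> 1 \<le> c * norm (subvec x (J i))"
  shows "real (card T) \<le> c\<^sup>2 * (norm (x - z))\<^sup>2"
proof -
  have "real (card T) = (\<Sum>i\<in>T. 1)" by simp
  also have "\<dots> \<le> (\<Sum>i\<in>T. c\<^sup>2 * (norm (subvec (x - z) (J i)))\<^sup>2)"
  proof (rule sum_mono)
    fix i assume "i \<in> T"
    then have "1 \<le> c * norm (subvec (x - z) (J i))" using z large by (simp add: subvec_diff)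
    then show "1 \<le> c\<^sup>2 * (norm (subvec (x - z) (J i)))\<^sup>2"
      by (metis one_le_power power_mult_distrib)
  qed
  also have "\<dots> \<le> c\<^sup>2 * (norm (x - z))\<^sup>2"
    unfolding sum_distrib_left[symmetric]
    by (subst norm_power2_eq_sum_subvec[OF J, of "x - z"]) (intro mult_left_mono sum_mono2, auto)
  finally show ?thesis .
qed

text \<open>Feasibility of \<open>xbar\<close> lets it compete in every subproblem. The upper bound
  on \<open>\<nu>\<close> is conditional because a quotient by zero is 0 in HOL, whereas for
  vanishing noise the bound should be infinite.\<close>

theorem theorem4p1:
  fixes A :: "real ^ 'p::finite ^ 'n::finite"
    and xbar :: "real ^ 'p"
    and \<epsilon> b :: "real ^ 'n"
    and J :: "'m::finite \<Rightarrow> 'p set"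
    and \<phi> :: "real \<Rightarrow> ereal"
    and \<nu> \<rho> \<kappa> R :: real
    and w :: "nat \<Rightarrow> real ^ 'm"
    and x :: "nat \<Rightarrow> real ^ 'p"
    and Sbar :: "'m set"
    and rbar :: nat
    and \<epsilon>hat :: "real ^ 'p"
    and ts tb :: real
  assumes partition: "group_partition J"
    and R_pos: "R > 0"
    and xbar_feasible: "xbar \<in> Omega R"
    and b_eq: "b = A *v xbar + \<epsilon>"
    and Sbar_eq: "Sbar = group_support J xbar"
    and rbar_eq: "rbar = card Sbar"
    and \<epsilon>hat_eq: "\<epsilon>hat = (1 / real CARD('n)) *\<^sub>R (transpose A *v \<epsilon>)"
    and ts_eq: "ts = t_star \<phi>"
    and tb_eq: "tb = t_bar \<phi>"
    and alg: "GEP_MSCRA \<phi> \<nu> \<rho> R J A b w x"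
    and rsc: "RSC A \<kappa> (cone_set \<phi> J Sbar (1.5 * real rbar))"
    and \<nu>_lower: "sqrt 3 * (4 - 2 * tb) * (1 - ts) / ((3 - tb) * \<kappa>) \<le> \<nu>"
    and \<nu>_upper: "infnorm (group_norms J \<epsilon>hat) \<noteq> 0 \<Longrightarrow>
      \<nu> \<le> (1 - tb) / ((3 - tb) * infnorm (group_norms J \<epsilon>hat))"
    and \<rho>_lower: "\<nu> * (3 - tb) * infnorm (group_norms J \<epsilon>hat) / (1 - tb) \<le> \<rho>"
    and \<rho>_upper: "\<rho> \<le> sqrt ((3 - tb) * \<kappa> * \<nu> / (sqrt 3 * (4 - 2 * tb) * (1 - ts)))"
  shows "norm (x 1 - xbar)
           \<le> inverse \<nu> * (4 - 2 * tb) / (\<kappa> * (3 - tb)) * sqrt (1.5 * real rbar) \<and>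
         (\<forall>k\<ge>2. norm (x k - xbar)
           \<le> \<rho> * inverse \<nu> * (4 - 2 * tb) / (\<kappa> * (3 - tb)) * sqrt (1.5 * real rbar))"
proof -
  have \<phi>: "\<phi> \<in> Phi_family" and \<nu>: "\<nu> > 0" and "\<rho> > rho_bar \<phi> \<nu> R A b"
    using alg by (auto simp: GEP_MSCRA_def)
  then have \<rho>: "\<rho> > 0" using rho_bar_nonneg[OF \<phi> \<nu>] by (meson le_less_trans)
  have w0: "0 \<le> w 0 $ i" "w 0 $ i \<le> tb" for i
    using alg by (auto simp: GEP_MSCRA_def tb_eq)
  \<comment> \<open>Indices are shifted by one from here on: \<open>x (Suc k)\<close> is computed
    from the weights \<open>w k\<close>.\<close>
  have xmin: "is_arg_min
        (\<lambda>y. least_squares A b y +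
           penalty_param \<nu> \<rho> k * (\<Sum>i\<in>UNIV. (1 - w k $ i) * norm (subvec y (J i))))
        (\<lambda>y. y \<in> Omega R) (x (Suc k))" for k
    using alg[unfolded GEP_MSCRA_def, THEN conjunct2, THEN conjunct2, THEN conjunct2,
        THEN conjunct2, THEN conjunct1, rule_format, of "Suc k"] by simp
  have wmin: "is_arg_min (\<lambda>t. \<phi> t - ereal (\<rho> * t * norm (subvec (x (Suc k)) (J i))))
        (\<lambda>t. t \<in> {0..1}) (w (Suc k) $ i)" for k i
    using alg[unfolded GEP_MSCRA_def, THEN conjunct2, THEN conjunct2, THEN conjunct2,
        THEN conjunct2, THEN conjunct2, rule_format, of "Suc k"] by simp
  have ts: "ts < 1" and tb: "0 \<le> tb" "tb < 1"
    using t_star_props[OF \<phi>] t_bar_props[OF \<phi>] by (auto simp: ts_eq tb_eq)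
  have w: "0 \<le> w k $ i" "w k $ i \<le> 1" for k i
  proof -
    show "0 \<le> w k $ i" using w0[of i] wmin[of "k - 1" i] by (cases k) (auto simp: is_arg_min_def)
    show "w k $ i \<le> 1" using w0[of i] tb wmin[of "k - 1" i] by (cases k) (auto simp: is_arg_min_def)
  qed
  have \<kappa>: "\<kappa> > 0" using rsc by (simp add: RSC_def)
  define \<eta> where "\<eta> = infnorm (group_norms J \<epsilon>hat)"
  define \<Lambda> where "\<Lambda> = penalty_param \<nu> \<rho>"
  define q where "q = (4 - 2 * tb) / (\<kappa> * (3 - tb))"
  define c where "c = q * (1 - ts)"
  define l where "l = 1.5 * real rbar"
  have q: "q > 0" and c: "c > 0" using tb ts \<kappa> by (auto simp: q_def c_def)
  have \<Lambda>_cases: "\<Lambda> k = 1 / \<nu> \<or> \<Lambda> k = \<rho> / \<nu>" for k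
    by (simp add: \<Lambda>_def penalty_param_def divide_inverse)
  have \<Lambda>_pos: "\<Lambda> k > 0" for k using \<Lambda>_cases[of k] \<nu> \<rho> by auto
  \<comment> \<open>The upper bound on \<open>\<nu>\<close> covers the parameter
    \<open>1 / \<nu>\<close>, the lower bound on \<open>\<rho>\<close> covers
    \<open>\<rho> / \<nu>\<close>.\<close>
  have noise: "\<eta> \<le> \<Lambda> k * (1 - tb) / (3 - tb)" for k
  proof -
    have "\<eta> \<ge> 0" by (simp add: \<eta>_def infnorm_pos_le)
    have "\<eta> * (3 - tb) \<le> 1 / \<nu> * (1 - tb)"
    proof (cases "\<eta> = 0")
      case False
      then have "\<nu> \<le> (1 - tb) / ((3 - tb) * \<eta>)" using \<nu>_upper by (simp add: \<eta>_def)
      then show ?thesis using False \<open>\<eta> \<ge> 0\<close> \<nu> tb by (simp add: field_simps)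
    qed (use \<nu> tb in simp)
    moreover have "\<eta> * (3 - tb) \<le> \<rho> / \<nu> * (1 - tb)"
      using \<rho>_lower \<nu> tb by (simp add: \<eta>_def[symmetric] field_simps)
    ultimately have "\<eta> * (3 - tb) \<le> \<Lambda> k * (1 - tb)" using \<Lambda>_cases[of k] by auto
    then show ?thesis using tb by (simp add: pos_le_divide_eq)
  qed
  have c1: "sqrt 3 * c \<le> \<nu>"
    using \<nu>_lower by (simp add: c_def q_def mult_ac)
  have "\<rho> \<le> sqrt (\<nu> / (sqrt 3 * c))"
    using \<rho>_upper by (simp add: c_def q_def mult_ac)
  then have "\<rho>\<^sup>2 \<le> \<nu> / (sqrt 3 * c)" using \<rho> by (intro sqrt_ge_absD) simp
  then have c2: "sqrt 3 * (\<rho>\<^sup>2 * c) \<le> \<nu>" using c by (simp add: field_simps)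
  \<comment> \<open>This factor will limit the number of spurious groups to \<open>l / 3\<close>.
    For \<open>\<Lambda> k = 1 / \<nu>\<close> it is the product of \<open>c1\<close> and
    \<open>c2\<close>, for \<open>\<Lambda> k = \<rho> / \<nu>\<close> the square of
    \<open>c2\<close>.\<close>
  have contraction: "3 * (\<rho> * c * \<Lambda> k)\<^sup>2 \<le> 1" for k
  proof -
    have "\<Lambda> k * \<nu> = 1 \<or> \<Lambda> k * \<nu> = \<rho>" using \<Lambda>_cases[of k] \<nu> by auto
    then have "3 * (\<rho> * c * (\<Lambda> k * \<nu>))\<^sup>2 \<le> \<nu>\<^sup>2"
    proof
      assume 1: "\<Lambda> k * \<nu> = 1"
      have "(sqrt 3 * c) * (sqrt 3 * (\<rho>\<^sup>2 * c)) \<le> \<nu> * \<nu>"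
        using c1 c2 c \<nu> by (intro mult_mono) auto
      moreover have "(sqrt 3 * c) * (sqrt 3 * (\<rho>\<^sup>2 * c)) = (sqrt 3)\<^sup>2 * (\<rho> * c)\<^sup>2"
        by (simp only: power2_eq_square mult_ac)
      ultimately show ?thesis unfolding 1 by (simp add: power2_eq_square[of \<nu>])
    next
      assume 1: "\<Lambda> k * \<nu> = \<rho>"
      have "(sqrt 3 * (\<rho>\<^sup>2 * c))\<^sup>2 \<le> \<nu>\<^sup>2" using c2 c by (intro power_mono) auto
      then show ?thesis unfolding 1 by (simp add: power2_eq_square mult_ac)
    qed
    then have "3 * (\<rho> * c * \<Lambda> k)\<^sup>2 * \<nu>\<^sup>2 \<le> 1 * \<nu>\<^sup>2" by (simp add: power_mult_distrib mult_ac)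
    then show ?thesis using \<nu> by simp
  qed
  define S where "S = (\<lambda>k. Sbar \<union> {i. w k $ i > tb})"
  have step: "norm (x (Suc k) - xbar) \<le> \<Lambda> k * q * sqrt l" if "real (card (S k)) \<le> l" for k
    unfolding q_def
  proof (rule subproblem_error_bound[OF partition b_eq xbar_feasible xmin[folded \<Lambda>_def] \<Lambda>_pos tb_eq])
    show "RSC A \<kappa> (cone_set \<phi> J (group_support J xbar) l)" using rsc by (simp add: l_def Sbar_eq)
    show "real (card (S k)) \<le> l" by fact
    show "infnorm (group_norms J ((1 / real CARD('n)) *\<^sub>R (transpose A *v \<epsilon>)))
        \<le> \<Lambda> k * (1 - tb) / (3 - tb)"
      using noise by (simp add: \<eta>_def \<epsilon>hat_eq)
  qed (use w tb in \<open>auto simp: S_def Sbar_eq\<close>)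
  have card_S: "real (card (S k)) \<le> l" for k
  proof (induction k)
    case 0
    \<comment> \<open>The initial weights do not exceed \<open>tb\<close>, so no spurious group is
      present at the start.\<close>
    have "S 0 = Sbar" using w0(2) by (auto simp: S_def simp flip: not_le)
    then show ?case by (simp add: l_def rbar_eq)
  next
    case (Suc k)
    define T where "T = S (Suc k) - Sbar"
    have "real (card T) \<le> (\<rho> * (1 - ts))\<^sup>2 * (norm (x (Suc k) - xbar))\<^sup>2"
    proof (rule card_large_groups[OF partition])
      fix i assume i: "i \<in> T"
      then show "subvec xbar (J i) = 0" by (auto simp: T_def Sbar_eq group_support_def)
      have "w (Suc k) $ i > t_bar \<phi>" using i by (auto simp: T_def S_def tb_eq)
      from weight_above_t_bar[OF \<phi> wmin this]
      show "1 \<le> \<rho> * (1 - ts) * norm (subvec (x (Suc k)) (J i))" by (simp add: ts_eq mult_ac)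
    qed
    also have "\<dots> \<le> (\<rho> * (1 - ts))\<^sup>2 * (\<Lambda> k * q * sqrt l)\<^sup>2"
      using step[OF Suc] by (intro mult_left_mono power_mono) auto
    also have "\<dots> = (\<rho> * c * \<Lambda> k)\<^sup>2 * l"
      by (simp add: c_def power_mult_distrib l_def)
    also have "\<dots> \<le> 1 / 3 * l"
      using contraction[of k] by (intro mult_right_mono) (auto simp: l_def)
    \<comment> \<open>One third of \<open>l = 1.5 * rbar\<close> is exactly the surplus of
      \<open>l\<close> over \<open>rbar\<close>, so the induction closes.\<close>
    finally have "real (card T) \<le> real rbar / 2" by (simp add: l_def)
    moreover have "S (Suc k) = Sbar \<union> T" "Sbar \<inter> T = {}" by (auto simp: T_def S_def)
    then have "card (S (Suc k)) = rbar + card T" by (simp add: card_Un_disjoint rbar_eq)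
    ultimately show ?case by (simp add: l_def)
  qed
  have bound: "norm (x (Suc k) - xbar) \<le> \<Lambda> k * q * sqrt l" for k
    by (rule step[OF card_S])
  show ?thesis
  proof (intro conjI allI impI)
    show "norm (x 1 - xbar) \<le> inverse \<nu> * (4 - 2 * tb) / (\<kappa> * (3 - tb)) * sqrt (1.5 * real rbar)"
      using bound[of 0] by (simp add: \<Lambda>_def penalty_param_def q_def l_def)
  next
    fix k :: nat
    assume "k \<ge> 2"
    \<comment> \<open>Since \<open>j \<noteq> 0\<close>, the parameter \<open>\<Lambda> j\<close> is
      already \<open>\<rho> / \<nu>\<close>; only \<open>x 1\<close> is computed with
      \<open>1 / \<nu>\<close>.\<close>
    then obtain j where "k = Suc j" "j \<noteq> 0" by (cases k) auto
    then show "norm (x k - xbar)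
        \<le> \<rho> * inverse \<nu> * (4 - 2 * tb) / (\<kappa> * (3 - tb)) * sqrt (1.5 * real rbar)"
      using bound[of j] by (simp add: \<Lambda>_def penalty_param_def q_def l_def)
  qed
qed

end
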